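(* In the finite-scenario setting of the context, for every $\rho>0$ the extended-valued function $\Psi_\rho:=\Phi_\rho+\delta_{\mathcal X}$ on $\mathbb R^{nT}$ is a proper closed piecewise linear--quadratic function. Moreover, it is semi-algebraic and has the Kurdyka--\L{}ojasiewicz property with exponent $1/2$ at every point of $\operatorname{dom}\partial\Psi_\rho$.
   Context: Model. Let $n,T\in\mathbb N=\{1,2,\dots\}$. Let $X:=\{z\in\mathbb R^n:\sum_{i=1}^n z_i=1,\ z_i\ge 0,\ i=1,\dots,n\}$ and $\mathcal X:=X^T\subset(\mathbb R^n)^T\cong\mathbb R^{nT}$; elements are written $x=(x^1,\dots,x^T)$ with blocks $x^t\in\mathbb R^n$, and $\|\cdot\|$ is the Euclidean norm. Fix $w_{\mathrm{prev}}\in X$. For each $t=1,\dots,T$ let $S_t\in\mathbb N$ and let $\xi^t$ be a discrete random vector taking values $\xi^t_j\in\mathbb R^n$ with probabilities $p^t_j>0$, $j=1,\dots,S_t$, $\sum_{j=1}^{S_t}p^t_j=1$; put $\mu^t:=\sum_{j=1}^{S_t}p_j^t\xi_j^t$. Fix $\alpha\in(0,1)$, $\lambda_1>0$, $\lambda_2>0$, $c_i\ge 0$ ($i=1,\dots,n$), and $\tau\in\mathbb R$. For a real random variable $L$, $\operatorname{VaR}_\alpha(L):=\inf\{u\in\mathbb R:\mathbb P(L\le u)\ge\alpha\}$. $f(x):=-\sum_{t=1}^T(\mu^t)^\top x^t+\lambda_1\Big[\sum_{i=1}^n c_i|x_i^1-(w_{\mathrm{prev}})_i|+\sum_{t=2}^T\sum_{i=1}^n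 c_i|x_i^t-x_i^{t-1}|\Big]+\lambda_2\sum_{t=1}^T\|x^t\|^2$; $R(x):=\sum_{t=1}^T\big(\operatorname{VaR}_\alpha(-(\xi^t)^\top x^t)-\tau\big)_+$ with $(a)_+:=\max\{a,0\}$; for $\rho>0$, $\Phi_\rho:=f+\rho R$. $\delta_{\mathcal X}(x)=0$ if $x\in\mathcal X$ and $+\infty$ otherwise. $\partial\Psi_\rho$ denotes the limiting (Mordukhovich) subdifferential and $\operatorname{dom}\partial\Psi_\rho=\{x:\partial\Psi_\rho(x)\ne\varnothing\}$. Piecewise linear--quadratic: the effective domain is a finite union of polyhedra on each of which the function is given by a polynomial of degree at most two. Closed means lower semicontinuous; semi-algebraic means the graph is a semi-algebraic set. KL property: a proper closed function $h$ has the KL property at $\bar x\in\operatorname{dom}\partial h$ with exponent $\vartheta\in[0,1)$ if there exist $c,\varepsilon,\zeta>0$ such that $\operatorname{dist}(0,\partial h(x))\ge c\,(h(x)-h(\bar x))^{\vartheta}$ whenever $\|x-\bar x\|<\varepsilon$ and $h(\bar x)<h(x)<h(\bar x)+\zeta$ (with $\operatorname{dist}(0,\varnothing)=+\infty$). *)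

theory Defs
  imports "HOL-Probability.Probability"
begin

section \<open>Extended-real-valued functions on Euclidean spaces\<close>

definition edom :: "('a \<Rightarrow> ereal) \<Rightarrow> 'a set" where
  "edom h = {x. h x < \<infinity>}"

definition proper_fun :: "('a \<Rightarrow> ereal) \<Rightarrow> bool" where
  "proper_fun h \<longleftrightarrow> edom h \<noteq> {} \<and> (\<forall>x. h x \<noteq> -\<infinity>)"

text \<open>Closed means lower semicontinuous.\<close>

definition closed_fun :: "('a::topological_space \<Rightarrow> ereal) \<Rightarrow> bool" where
  "closed_fun h \<longleftrightarrow> (\<forall>x. h x \<le> Liminf (at x) h)"

definition indicator_fun :: "'a set \<Rightarrow> 'a \<Rightarrow> ereal" where
  "indicator_fun C x = (if x \<in> C then 0 else \<infinity>)"

text \<open>A polynomial of degree at most \<open>d\<close> in the coordinates \<open>x \<bullet> b\<close>, \<open>b \<in> Basis\<close>;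
  the finite set \<open>I\<close> lists the exponent vectors of the monomials.\<close>

definition polynomial_deg_le :: "nat \<Rightarrow> ('a::euclidean_space \<Rightarrow> real) \<Rightarrow> bool" where
  "polynomial_deg_le d q \<longleftrightarrow>
     (\<exists>(I :: ('a \<Rightarrow> nat) set) a. finite I \<and> (\<forall>m\<in>I. (\<Sum>b\<in>Basis. m b) \<le> d) \<and>
        (\<forall>x. q x = (\<Sum>m\<in>I. a m * (\<Prod>b\<in>Basis. (x \<bullet> b) ^ m b))))"

definition piecewise_linear_quadratic :: "('a::euclidean_space \<Rightarrow> ereal) \<Rightarrow> bool" where
  "piecewise_linear_quadratic h \<longleftrightarrow>
     (\<exists>\<C>. finite \<C> \<and> edom h = \<Union>\<C> \<and>
        (\<forall>C\<in>\<C>. polyhedron C \<and> (\<exists>q. polynomial_deg_le 2 q \<and> (\<forall>x\<in>C. h x = ereal (q x)))))"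

definition semialgebraic_set :: "'a::euclidean_space set \<Rightarrow> bool" where
  "semialgebraic_set S \<longleftrightarrow>
     (\<exists>\<B>. finite \<B> \<and> S = \<Union>\<B> \<and>
        (\<forall>B\<in>\<B>. \<exists>P Q. finite P \<and> finite Q \<and>
           (\<forall>g \<in> P \<union> Q. real_polynomial_function g) \<and>
           B = {x. (\<forall>g\<in>P. g x = 0) \<and> (\<forall>g\<in>Q. g x > 0)}))"

text \<open>The graph of an extended-real-valued function consists of its finite values only.\<close>

definition semialgebraic_fun :: "('a::euclidean_space \<Rightarrow> ereal) \<Rightarrow> bool" where
  "semialgebraic_fun h \<longleftrightarrow> semialgebraic_set {(x, r :: real). h x = ereal r}"

definition frechet_subdiff :: "('a::real_inner \<Rightarrow> ereal) \<Rightarrow> 'a \<Rightarrow> 'a set" where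
  "frechet_subdiff h x =
     {v. \<bar>h x\<bar> \<noteq> \<infinity> \<and>
         0 \<le> Liminf (at x) (\<lambda>y. (h y - h x - ereal (v \<bullet> (y - x))) / ereal (norm (y - x)))}"

definition limiting_subdiff :: "('a::real_inner \<Rightarrow> ereal) \<Rightarrow> 'a \<Rightarrow> 'a set" where
  "limiting_subdiff h x =
     {v. \<bar>h x\<bar> \<noteq> \<infinity> \<and>
         (\<exists>X V. X \<longlonglongrightarrow> x \<and> (\<lambda>k. h (X k)) \<longlonglongrightarrow> h x \<and>
            (\<forall>k::nat. V k \<in> frechet_subdiff h (X k)) \<and> V \<longlonglongrightarrow> v)}"

definition dom_subdiff :: "('a::real_inner \<Rightarrow> ereal) \<Rightarrow> 'a set" where
  "dom_subdiff h = {x. limiting_subdiff h x \<noteq> {}}"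

text \<open>Unlike \<^const>\<open>infdist\<close> and \<^const>\<open>setdist\<close>, the distance to the empty set is \<open>\<infinity>\<close> here.\<close>

definition edist_set :: "'a::metric_space \<Rightarrow> 'a set \<Rightarrow> ereal" where
  "edist_set x A = (INF y\<in>A. ereal (dist x y))"

definition KL_property_at :: "('a::real_inner \<Rightarrow> ereal) \<Rightarrow> real \<Rightarrow> 'a \<Rightarrow> bool" where
  "KL_property_at h \<theta> z \<longleftrightarrow>
     proper_fun h \<and> closed_fun h \<and> z \<in> dom_subdiff h \<and> 0 \<le> \<theta> \<and> \<theta> < 1 \<and>
     (\<exists>c>0. \<exists>\<epsilon>>0. \<exists>\<zeta>>0. \<forall>x.
        norm (x - z) < \<epsilon> \<and> h z < h x \<and> h x < h z + ereal \<zeta> \<longrightarrow>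
        ereal (c * (real_of_ereal (h x) - real_of_ereal (h z)) powr \<theta>)
          \<le> edist_set 0 (limiting_subdiff h x))"

section \<open>The portfolio model\<close>

text \<open>Assets are indexed by a finite type \<open>'n\<close> and the periods \<open>1,\<dots>,T\<close> by a finite linearly
  ordered type \<open>'t\<close>, so \<open>x :: real^'n^'t\<close> has the blocks \<open>x $ t\<close>, and the norm of
  \<open>real^'n^'t\<close> is the Euclidean norm of the concatenated vector.\<close>

definition first_period :: "'t::{finite,linorder}" where
  "first_period = Min UNIV"

definition prev_period :: "'t::{finite,linorder} \<Rightarrow> 't" where
  "prev_period t = Max {s. s < t}"  \<comment> \<open>only used for \<open>t \<noteq> first_period\<close>\<close>

definition unit_simplex :: "(real^'n) set" where
  "unit_simplex = {z. (\<Sum>i\<in>UNIV. z $ i) = 1 \<and> (\<forall>i. 0 \<le> z $ i)}"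

definition feasible_set :: "(real^'n^'t) set" where
  "feasible_set = {x. \<forall>t. x $ t \<in> unit_simplex}"

text \<open>The scenarios \<open>v j\<close>, \<open>j = 1,\<dots>,S\<close>, need not be distinct; the probabilities of coinciding
  scenarios add up.\<close>

definition has_scenarios ::
  "'w measure \<Rightarrow> ('w \<Rightarrow> 'a::topological_space) \<Rightarrow> nat \<Rightarrow> (nat \<Rightarrow> real) \<Rightarrow> (nat \<Rightarrow> 'a) \<Rightarrow> bool" where
  "has_scenarios M Z S p v \<longleftrightarrow>
     Z \<in> borel_measurable M \<and>
     (\<forall>y. measure M {\<omega> \<in> space M. Z \<omega> = y} = (\<Sum>j \<in> {j \<in> {1..S}. v j = y}. p j))"

definition VaR :: "'w measure \<Rightarrow> real \<Rightarrow> ('w \<Rightarrow> real) \<Rightarrow> real" where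
  "VaR M \<alpha> L = Inf {u. \<alpha> \<le> measure M {\<omega> \<in> space M. L \<omega> \<le> u}}"

definition scenario_mean :: "nat \<Rightarrow> (nat \<Rightarrow> real) \<Rightarrow> (nat \<Rightarrow> 'a) \<Rightarrow> 'a::real_vector" where
  "scenario_mean S p v = (\<Sum>j\<in>{1..S}. p j *\<^sub>R v j)"

definition objective ::
  "('t \<Rightarrow> real^'n) \<Rightarrow> ('n \<Rightarrow> real) \<Rightarrow> real^'n \<Rightarrow> real \<Rightarrow> real
     \<Rightarrow> real^'n^('t::{finite,linorder}) \<Rightarrow> real" where
  "objective \<mu> c w lam1 lam2 x =
     - (\<Sum>t\<in>UNIV. \<mu> t \<bullet> x $ t)
     + lam1 * ((\<Sum>i\<in>UNIV. c i * \<bar>x $ first_period $ i - w $ i\<bar>)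
           + (\<Sum>t\<in>UNIV - {first_period}. \<Sum>i\<in>UNIV. c i * \<bar>x $ t $ i - x $ prev_period t $ i\<bar>))
     + lam2 * (\<Sum>t\<in>UNIV. (norm (x $ t))\<^sup>2)"

definition risk_penalty ::
  "'w measure \<Rightarrow> real \<Rightarrow> real \<Rightarrow> ('t::finite \<Rightarrow> 'w \<Rightarrow> real^'n) \<Rightarrow> real^'n^'t \<Rightarrow> real" where
  "risk_penalty M \<alpha> \<tau> \<xi> x = (\<Sum>t\<in>UNIV. max (VaR M \<alpha> (\<lambda>\<omega>. - (\<xi> t \<omega> \<bullet> x $ t)) - \<tau>) 0)"

end

theory Submission
  imports Defs
begin

text \<open>The value at risk of a discrete loss is a minimum over the sets \<open>J\<close> of scenarios of probability
  at least \<open>\<alpha>\<close> of the maximum of the scenario losses over \<open>J\<close>. Hence the objective is, on the feasible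
  polyhedron, a minimum of finitely many functions \<open>G\<^sub>J + \<lambda>\<^sub>2 \<parallel>\<cdot>\<parallel>\<^sup>2\<close> with \<open>G\<^sub>J\<close> convex and piecewise
  affine. A Frechet subgradient \<open>u\<close> at \<open>x\<close> is also one of every such function that is active at \<open>x\<close>,
  and for \<open>x\<close> near \<open>z\<close> that function is active at \<open>z\<close> as well; strong convexity then yields
  \<open>\<Phi> x - \<Phi> z \<le> \<parallel>u\<parallel>\<^sup>2 / (4 \<lambda>\<^sub>2)\<close>. This estimate passes to limiting subgradients and is the KL inequality
  with exponent \<open>1/2\<close>.\<close>

section \<open>Piecewise affine functions\<close>

text \<open>The pieces cover the whole space and may overlap, so no separate compatibility condition
  is required: all pieces describe values of the same \<open>g\<close>. The feasible set is
  intersected with them only at the end.\<close>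

definition piecewise_affine :: "('a::euclidean_space \<Rightarrow> real) \<Rightarrow> bool" where
  "piecewise_affine g \<longleftrightarrow>
     (\<exists>\<C>. finite \<C> \<and> \<Union>\<C> = UNIV \<and>
        (\<forall>C\<in>\<C>. polyhedron C \<and> (\<exists>a b. \<forall>x\<in>C. g x = a \<bullet> x + b)))"

lemma piecewise_affineI:
  assumes "finite \<C>" "\<Union>\<C> = UNIV" "\<And>C. C \<in> \<C> \<Longrightarrow> polyhedron C"
    and g: "\<And>C x. C \<in> \<C> \<Longrightarrow> x \<in> C \<Longrightarrow> g x = a C \<bullet> x + b C"
  shows "piecewise_affine g"
proof -
  have "\<exists>a b. \<forall>x\<in>C. g x = a \<bullet> x + b" if "C \<in> \<C>" for C
    by (intro exI ballI) (rule g[OF that])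
  then show ?thesis
    unfolding piecewise_affine_def using assms(1-3) by (intro exI[of _ \<C>]) simp
qed

text \<open>Choosing the coefficients as functions of the piece lets later constructions build new
  coefficients from old ones.\<close>

lemma piecewise_affineE:
  assumes "piecewise_affine g"
  obtains \<C> a b where "finite \<C>" "\<Union>\<C> = UNIV" "\<And>C. C \<in> \<C> \<Longrightarrow> polyhedron C"
    "\<And>C x. C \<in> \<C> \<Longrightarrow> x \<in> C \<Longrightarrow> g x = a C \<bullet> x + b C"
proof -
  obtain \<C> where C: "finite \<C>" "\<Union>\<C> = UNIV"
    "\<forall>C\<in>\<C>. polyhedron C \<and> (\<exists>a b. \<forall>x\<in>C. g x = a \<bullet> x + b)"
    using assms unfolding piecewise_affine_def by (elim exE conjE) (rule that)
  then have "\<forall>C\<in>\<C>. \<exists>a b. \<forall>x\<in>C. g x = a \<bullet> x + b" by simp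
  then obtain a where "\<forall>C\<in>\<C>. \<exists>b. \<forall>x\<in>C. g x = a C \<bullet> x + b" by (rule bchoice[THEN exE])
  then obtain b where "\<forall>C\<in>\<C>. \<forall>x\<in>C. g x = a C \<bullet> x + b C" by (rule bchoice[THEN exE])
  then show thesis using C by (intro that[of \<C> a b]) simp_all
qed

text \<open>Riesz representation: the representing vector is the adjoint evaluated at 1.\<close>

lemma linear_functional_eq_inner:
  fixes g :: "'a::euclidean_space \<Rightarrow> real"
  assumes "linear g"
  obtains a where "\<And>x. g x = a \<bullet> x"
proof
  show "g x = adjoint g 1 \<bullet> x" for x
    using adjoint_works[OF assms, of x 1] by (simp add: inner_commute)
qed

lemma piecewise_affine_affine: "piecewise_affine (\<lambda>x. a \<bullet> x + b)"
  by (rule piecewise_affineI[of "{UNIV}" _ "\<lambda>_. a" "\<lambda>_. b"]) auto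

lemma piecewise_affine_const: "piecewise_affine (\<lambda>x. b)"
  using piecewise_affine_affine[of 0 b] by simp

lemma piecewise_affine_linear:
  assumes "linear g" shows "piecewise_affine g"
proof -
  obtain a where "\<And>x. g x = a \<bullet> x" using linear_functional_eq_inner[OF assms] by blast
  then have "g = (\<lambda>x. a \<bullet> x + 0)" by auto
  then show ?thesis using piecewise_affine_affine[of a 0] by simp
qed

text \<open>On the common refinement of the two covers both summands are affine.\<close>

lemma piecewise_affine_add:
  assumes "piecewise_affine f" "piecewise_affine g"
  shows "piecewise_affine (\<lambda>x. f x + g x)"
proof -
  obtain \<A> a a0 where A: "finite \<A>" "\<Union>\<A> = UNIV" "\<And>C. C \<in> \<A> \<Longrightarrow> polyhedron C"
    "\<And>C x. C \<in> \<A> \<Longrightarrow> x \<in> C \<Longrightarrow> f x = a C \<bullet> x + a0 C"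
    by (rule piecewise_affineE[OF assms(1)]) (rule that)
  obtain \<B> b b0 where B: "finite \<B>" "\<Union>\<B> = UNIV" "\<And>C. C \<in> \<B> \<Longrightarrow> polyhedron C"
    "\<And>C x. C \<in> \<B> \<Longrightarrow> x \<in> C \<Longrightarrow> g x = b C \<bullet> x + b0 C"
    by (rule piecewise_affineE[OF assms(2)]) (rule that)
  define \<C> where "\<C> = (\<lambda>(C, D). C \<inter> D) ` (\<A> \<times> \<B>)"
  have "\<exists>C D. C \<in> \<A> \<and> D \<in> \<B> \<and> E = C \<inter> D" if "E \<in> \<C>" for E
    using that unfolding \<C>_def by auto
  \<comment> \<open>A cell of the refinement may arise from several pairs of pieces;
    \<open>l\<close> and \<open>r\<close> fix one pair per cell, so that the coefficients become
    functions of the cell.\<close>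
  then obtain l r where lr: "\<And>E. E \<in> \<C> \<Longrightarrow> l E \<in> \<A> \<and> r E \<in> \<B> \<and> E = l E \<inter> r E" by metis
  show ?thesis
  proof (rule piecewise_affineI)
    show "finite \<C>" unfolding \<C>_def using A(1) B(1) by simp
    have "\<Union>\<C> = \<Union>\<A> \<inter> \<Union>\<B>" unfolding \<C>_def by auto
    then show "\<Union>\<C> = UNIV" using A(2) B(2) by simp
    show "polyhedron E" if "E \<in> \<C>" for E
      using lr[OF that] A(3) B(3) polyhedron_Int by metis
    show "f x + g x = (a (l E) + b (r E)) \<bullet> x + (a0 (l E) + b0 (r E))" if "E \<in> \<C>" "x \<in> E" for E x
    proof -
      have "x \<in> l E" "x \<in> r E" using lr[OF that(1)] that(2) by blast+
      then have "f x = a (l E) \<bullet> x + a0 (l E)" "g x = b (r E) \<bullet> x + b0 (r E)"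
        using A(4) B(4) lr[OF that(1)] by blast+
      then show ?thesis by (simp add: inner_add_left)
    qed
  qed
qed

text \<open>Each piece is cut by the sign of its own affine form; both halves remain polyhedra.
  Together with the linear operations this yields maxima, minima and absolute values.\<close>

lemma piecewise_affine_positive_part:
  assumes "piecewise_affine f"
  shows "piecewise_affine (\<lambda>x. max (f x) 0)"
proof -
  obtain \<A> a b where A: "finite \<A>" "\<Union>\<A> = UNIV" "\<And>C. C \<in> \<A> \<Longrightarrow> polyhedron C"
    "\<And>C x. C \<in> \<A> \<Longrightarrow> x \<in> C \<Longrightarrow> f x = a C \<bullet> x + b C"
    by (rule piecewise_affineE[OF assms]) (rule that)
  define P where "P C = C \<inter> {x. a C \<bullet> x \<ge> - b C}" for C
  define N where "N C = C \<inter> {x. a C \<bullet> x \<le> - b C}" for C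
  define \<C> where "\<C> = P ` \<A> \<union> N ` \<A>"
  have "\<exists>a' b'. \<forall>x\<in>E. max (f x) 0 = a' \<bullet> x + b'" if E: "E \<in> \<C>" for E
  proof -
    consider C where "C \<in> \<A>" "E = P C" | C where "C \<in> \<A>" "E = N C"
      using E unfolding \<C>_def by blast
    then show ?thesis
    proof cases
      case 1
      then show ?thesis
        by (intro exI[of _ "a C"] exI[of _ "b C"]) (simp add: P_def A(4))
    next
      case 2
      then show ?thesis
        by (intro exI[of _ 0]) (simp add: N_def A(4))
    qed
  qed
  then obtain a' b' where ab': "\<And>E x. E \<in> \<C> \<Longrightarrow> x \<in> E \<Longrightarrow> max (f x) 0 = a' E \<bullet> x + b' E" by metis
  show ?thesis
  proof (rule piecewise_affineI[OF _ _ _ ab'])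
    show "finite \<C>" unfolding \<C>_def using A(1) by simp
    have "P C \<union> N C = C" for C unfolding P_def N_def by auto
    then have "\<Union>\<C> = \<Union>\<A>" unfolding \<C>_def by blast
    then show "\<Union>\<C> = UNIV" using A(2) by simp
    have "polyhedron (P C)" "polyhedron (N C)" if "C \<in> \<A>" for C
      unfolding P_def N_def using A(3)[OF that]
      by (intro polyhedron_Int polyhedron_halfspace_le polyhedron_halfspace_ge; assumption)+
    then show "polyhedron E" if "E \<in> \<C>" for E
      using that unfolding \<C>_def by blast
  qed
qed

lemma piecewise_affine_cmul:
  assumes "piecewise_affine f"
  shows "piecewise_affine (\<lambda>x. k * f x)"
proof -
  obtain \<C> a b where C: "finite \<C>" "\<Union>\<C> = UNIV" "\<And>C. C \<in> \<C> \<Longrightarrow> polyhedron C"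
    "\<And>C x. C \<in> \<C> \<Longrightarrow> x \<in> C \<Longrightarrow> f x = a C \<bullet> x + b C"
    by (rule piecewise_affineE[OF assms]) (rule that)
  show ?thesis
    by (rule piecewise_affineI[OF C(1-3), of _ "\<lambda>C. k *\<^sub>R a C" "\<lambda>C. k * b C"])
      (simp_all add: C(4) distrib_left)
qed

lemma piecewise_affine_minus:
  "piecewise_affine f \<Longrightarrow> piecewise_affine (\<lambda>x. - f x)"
  using piecewise_affine_cmul[of f "-1"] by simp

lemma piecewise_affine_diff:
  "piecewise_affine f \<Longrightarrow> piecewise_affine g \<Longrightarrow> piecewise_affine (\<lambda>x. f x - g x)"
  using piecewise_affine_add[of f "\<lambda>x. - g x"] piecewise_affine_minus[of g] by simp

lemma piecewise_affine_max:
  assumes "piecewise_affine f" "piecewise_affine g"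
  shows "piecewise_affine (\<lambda>x. max (f x) (g x))"
proof -
  have "(\<lambda>x. max (f x) (g x)) = (\<lambda>x. g x + max (f x - g x) 0)" by (auto simp: max_def)
  then show ?thesis using assms
    by (simp add: piecewise_affine_add piecewise_affine_diff piecewise_affine_positive_part)
qed

lemma piecewise_affine_min:
  assumes "piecewise_affine f" "piecewise_affine g"
  shows "piecewise_affine (\<lambda>x. min (f x) (g x))"
proof -
  have "(\<lambda>x. min (f x) (g x)) = (\<lambda>x. - max (- f x) (- g x))" by (auto simp: min_def max_def)
  then show ?thesis using assms by (simp add: piecewise_affine_minus piecewise_affine_max)
qed

lemma piecewise_affine_abs:
  assumes "piecewise_affine f" shows "piecewise_affine (\<lambda>x. \<bar>f x\<bar>)"
proof -
  have "(\<lambda>x. \<bar>f x\<bar>) = (\<lambda>x. max (f x) (- f x))" by (auto simp: max_def)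
  then show ?thesis using assms by (simp add: piecewise_affine_minus piecewise_affine_max)
qed

lemma piecewise_affine_sum:
  assumes "\<And>i. i \<in> I \<Longrightarrow> piecewise_affine (f i)"
  shows "piecewise_affine (\<lambda>x. \<Sum>i\<in>I. f i x)"
  using assms
  by (induction I rule: infinite_finite_induct)
     (auto intro: piecewise_affine_const piecewise_affine_add)

lemma piecewise_affine_Max:
  assumes "finite I" "I \<noteq> {}" "\<And>i. i \<in> I \<Longrightarrow> piecewise_affine (f i)"
  shows "piecewise_affine (\<lambda>x. Max ((\<lambda>i. f i x) ` I))"
  using assms by (induction I rule: finite_ne_induct) (auto intro: piecewise_affine_max)

lemma piecewise_affine_Min:
  assumes "finite I" "I \<noteq> {}" "\<And>i. i \<in> I \<Longrightarrow> piecewise_affine (f i)"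
  shows "piecewise_affine (\<lambda>x. Min ((\<lambda>i. f i x) ` I))"
  using assms by (induction I rule: finite_ne_induct) (auto intro: piecewise_affine_min)

text \<open>Polyhedra are closed, and a function that is continuous on each member of a finite
  closed cover is continuous.\<close>

lemma piecewise_affine_continuous_on:
  assumes "piecewise_affine f"
  shows "continuous_on UNIV f"
proof -
  obtain \<C> a b where C: "finite \<C>" "\<Union>\<C> = UNIV" "\<And>C. C \<in> \<C> \<Longrightarrow> polyhedron C"
    "\<And>C x. C \<in> \<C> \<Longrightarrow> x \<in> C \<Longrightarrow> f x = a C \<bullet> x + b C"
    by (rule piecewise_affineE[OF assms]) (rule that)
  have "continuous_on C f" if "C \<in> \<C>" for C
  proof -
    have "continuous_on C (\<lambda>x. a C \<bullet> x + b C)" by (intro continuous_intros)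
    then show ?thesis using C(4)[OF that] by (simp cong: continuous_on_cong)
  qed
  then have "continuous_on (\<Union>C\<in>\<C>. C) f"
    using C by (intro continuous_on_closed_Union) (auto intro: polyhedron_imp_closed)
  then show ?thesis using C(2) by simp
qed

section \<open>Polynomials of bounded degree and piecewise linear-quadratic functions\<close>

lemma polynomial_deg_le_const: "polynomial_deg_le d (\<lambda>x. k)"
  unfolding polynomial_deg_le_def
  by (rule exI[of _ "{\<lambda>_. 0}"], rule exI[of _ "\<lambda>_. k"]) auto

lemma polynomial_deg_le_coordinate_power:
  assumes "b \<in> Basis" "e \<le> d"
  shows "polynomial_deg_le d (\<lambda>x. k * (x \<bullet> b) ^ e)"
proof -
  let ?m = "\<lambda>b'. if b' = b then e else 0"
  have "(\<Prod>b'\<in>Basis. (x \<bullet> b') ^ ?m b') = (x \<bullet> b) ^ e" for x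
  proof -
    have "(\<Prod>b'\<in>Basis. (x \<bullet> b') ^ ?m b') = (\<Prod>b'\<in>Basis. if b' = b then (x \<bullet> b) ^ e else 1)"
      by (rule prod.cong) auto
    then show ?thesis using assms by (simp add: prod.delta)
  qed
  then show ?thesis
    unfolding polynomial_deg_le_def using assms
    by (intro exI[of _ "{?m}"] exI[of _ "\<lambda>_. k"]) (auto simp: sum.delta)
qed

lemma polynomial_deg_le_add:
  assumes "polynomial_deg_le d f" "polynomial_deg_le d g"
  shows "polynomial_deg_le d (\<lambda>x. f x + g x)"
proof -
  let ?P = "\<lambda>m x. \<Prod>b\<in>Basis. (x \<bullet> b) ^ m b"
  obtain I a where I: "finite I" "\<forall>m\<in>I. (\<Sum>b\<in>Basis. m b) \<le> d" "\<And>x. f x = (\<Sum>m\<in>I. a m * ?P m x)"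
    using assms(1) unfolding polynomial_deg_le_def by blast
  obtain J b where J: "finite J" "\<forall>m\<in>J. (\<Sum>b\<in>Basis. m b) \<le> d" "\<And>x. g x = (\<Sum>m\<in>J. b m * ?P m x)"
    using assms(2) unfolding polynomial_deg_le_def by blast
  \<comment> \<open>The two exponent sets may overlap, so both coefficient families are extended by
    zero to the union and then added.\<close>
  let ?c = "\<lambda>m. (if m \<in> I then a m else 0) + (if m \<in> J then b m else 0)"
  have "f x + g x = (\<Sum>m\<in>I \<union> J. ?c m * ?P m x)" for x
  proof -
    have "f x = (\<Sum>m\<in>I \<union> J. (if m \<in> I then a m else 0) * ?P m x)"
      unfolding I(3) using I(1) J(1) by (intro sum.mono_neutral_cong_left) auto
    moreover have "g x = (\<Sum>m\<in>I \<union> J. (if m \<in> J then b m else 0) * ?P m x)"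
      unfolding J(3) using I(1) J(1) by (intro sum.mono_neutral_cong_left) auto
    ultimately show ?thesis by (simp add: distrib_right sum.distrib)
  qed
  then show ?thesis
    unfolding polynomial_deg_le_def using I J
    by (intro exI[of _ "I \<union> J"] exI[of _ ?c]) auto
qed

lemma polynomial_deg_le_sum:
  assumes "\<And>i. i \<in> I \<Longrightarrow> polynomial_deg_le d (f i)"
  shows "polynomial_deg_le d (\<lambda>x. \<Sum>i\<in>I. f i x)"
  using assms
  by (induction I rule: infinite_finite_induct)
     (auto intro: polynomial_deg_le_const polynomial_deg_le_add)

text \<open>This is the form of the objective on one piece; both the inner product and the squared
  norm expand in the orthonormal basis.\<close>

lemma polynomial_deg_le_affine_plus_norm_square:
  "polynomial_deg_le 2 (\<lambda>x. (a \<bullet> x + b) + k * (norm x)\<^sup>2)"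
proof -
  have "(a \<bullet> x + b) + k * (norm x)\<^sup>2 =
      ((\<Sum>u\<in>Basis. (a \<bullet> u) * (x \<bullet> u) ^ 1) + b) + (\<Sum>u\<in>Basis. k * (x \<bullet> u) ^ 2)" for x
  proof -
    have "(norm x)\<^sup>2 = (\<Sum>u\<in>Basis. (x \<bullet> u) ^ 2)"
      unfolding power2_norm_eq_inner using euclidean_inner[of x x] by (simp add: power2_eq_square)
    then show ?thesis using euclidean_inner[of a x] by (simp add: sum_distrib_left)
  qed
  moreover have "polynomial_deg_le 2 (\<lambda>x. ((\<Sum>u\<in>Basis. (a \<bullet> u) * (x \<bullet> u) ^ 1) + b)
      + (\<Sum>u\<in>Basis. k * (x \<bullet> u) ^ 2))"
    by (intro polynomial_deg_le_add polynomial_deg_le_sum polynomial_deg_le_const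
        polynomial_deg_le_coordinate_power) auto
  ultimately show ?thesis by (simp only:)
qed

lemma edom_add_indicator: "edom (\<lambda>x. ereal (g x) + indicator_fun X x) = X"
  by (auto simp: edom_def indicator_fun_def)

text \<open>The pieces are the intersections of \<open>X\<close> with the pieces of
  \<open>g\<close>. The quadratic term is common to all of them, so only the affine part
  varies.\<close>

lemma piecewise_linear_quadratic_norm_square:
  fixes X :: "'a::euclidean_space set"
  assumes "polyhedron X" and g: "piecewise_affine g"
  shows "piecewise_linear_quadratic (\<lambda>x. ereal (g x + k * (norm x)\<^sup>2) + indicator_fun X x)"
proof -
  obtain \<C> a b where C: "finite \<C>" "\<Union>\<C> = UNIV" "\<And>C. C \<in> \<C> \<Longrightarrow> polyhedron C"
    "\<And>C x. C \<in> \<C> \<Longrightarrow> x \<in> C \<Longrightarrow> g x = a C \<bullet> x + b C"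
    by (rule piecewise_affineE[OF g]) (rule that)
  have "\<exists>q. polynomial_deg_le 2 q \<and>
      (\<forall>x\<in>X \<inter> C. ereal (g x + k * (norm x)\<^sup>2) + indicator_fun X x = ereal (q x))" if "C \<in> \<C>" for C
  proof (intro exI conjI)
    show "polynomial_deg_le 2 (\<lambda>x. (a C \<bullet> x + b C) + k * (norm x)\<^sup>2)"
      by (rule polynomial_deg_le_affine_plus_norm_square)
    show "\<forall>x\<in>X \<inter> C. ereal (g x + k * (norm x)\<^sup>2) + indicator_fun X x
        = ereal ((a C \<bullet> x + b C) + k * (norm x)\<^sup>2)"
      using C(4)[OF that] by (simp add: indicator_fun_def)
  qed
  moreover have "X = \<Union>((\<lambda>C. X \<inter> C) ` \<C>)" using C(2) by auto
  ultimately show ?thesis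
    unfolding piecewise_linear_quadratic_def edom_add_indicator using C(1,3) assms(1)
    by (intro exI[of _ "(\<lambda>C. X \<inter> C) ` \<C>"]) simp
qed

section \<open>Semi-algebraic sets\<close>

text \<open>The innermost building block of \<open>semialgebraic_set\<close>, named so that unions
  and intersections can be handled without unfolding the polynomials.\<close>

definition basic_semialgebraic_set :: "'a::euclidean_space set \<Rightarrow> bool" where
  "basic_semialgebraic_set B \<longleftrightarrow>
     (\<exists>P Q. finite P \<and> finite Q \<and> (\<forall>g \<in> P \<union> Q. real_polynomial_function g) \<and>
        B = {x. (\<forall>g\<in>P. g x = 0) \<and> (\<forall>g\<in>Q. g x > 0)})"

lemma semialgebraic_set_iff_basic:
  "semialgebraic_set S \<longleftrightarrow>
     (\<exists>\<B>. finite \<B> \<and> S = \<Union>\<B> \<and> (\<forall>B\<in>\<B>. basic_semialgebraic_set B))"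
  unfolding semialgebraic_set_def basic_semialgebraic_set_def ..

lemma basic_semialgebraic_setI:
  assumes "finite P" "finite Q" "\<And>g. g \<in> P \<union> Q \<Longrightarrow> real_polynomial_function g"
  shows "basic_semialgebraic_set {x. (\<forall>g\<in>P. g x = 0) \<and> (\<forall>g\<in>Q. g x > 0)}"
  unfolding basic_semialgebraic_set_def using assms
  by (intro exI[of _ P] exI[of _ Q] conjI ballI refl)

lemma basic_semialgebraic_set_Int:
  assumes "basic_semialgebraic_set C" "basic_semialgebraic_set D"
  shows "basic_semialgebraic_set (C \<inter> D)"
proof -
  obtain P Q where PQ: "finite P" "finite Q" "\<forall>g \<in> P \<union> Q. real_polynomial_function g"
    "C = {x. (\<forall>g\<in>P. g x = 0) \<and> (\<forall>g\<in>Q. g x > 0)}"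
    using assms(1) unfolding basic_semialgebraic_set_def by (elim exE conjE) (rule that)
  obtain P' Q' where PQ': "finite P'" "finite Q'" "\<forall>g \<in> P' \<union> Q'. real_polynomial_function g"
    "D = {x. (\<forall>g\<in>P'. g x = 0) \<and> (\<forall>g\<in>Q'. g x > 0)}"
    using assms(2) unfolding basic_semialgebraic_set_def by (elim exE conjE) (rule that)
  have "basic_semialgebraic_set {x. (\<forall>g\<in>P \<union> P'. g x = 0) \<and> (\<forall>g\<in>Q \<union> Q'. g x > 0)}"
    using PQ(1-3) PQ'(1-3) by (intro basic_semialgebraic_setI) auto
  moreover have "{x. (\<forall>g\<in>P \<union> P'. g x = 0) \<and> (\<forall>g\<in>Q \<union> Q'. g x > 0)} = C \<inter> D"
    unfolding PQ(4) PQ'(4) by (auto simp only: ball_Un)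
  ultimately show ?thesis by simp
qed

lemma basic_imp_semialgebraic_set: "basic_semialgebraic_set B \<Longrightarrow> semialgebraic_set B"
  unfolding semialgebraic_set_iff_basic by (intro exI[of _ "{B}"]) simp

lemma semialgebraic_set_Union:
  assumes "finite \<F>" "\<And>S. S \<in> \<F> \<Longrightarrow> semialgebraic_set S"
  shows "semialgebraic_set (\<Union>\<F>)"
proof -
  have "\<forall>S\<in>\<F>. \<exists>\<B>. finite \<B> \<and> S = \<Union>\<B> \<and> (\<forall>B\<in>\<B>. basic_semialgebraic_set B)"
    using assms(2) unfolding semialgebraic_set_iff_basic by blast
  from bchoice[OF this] obtain \<B> where
    B: "\<forall>S\<in>\<F>. finite (\<B> S) \<and> S = \<Union>(\<B> S) \<and> (\<forall>B\<in>\<B> S. basic_semialgebraic_set B)" ..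
  have "\<Union>\<F> = \<Union>(\<Union>(\<B> ` \<F>))" using B by blast
  then show ?thesis
    unfolding semialgebraic_set_iff_basic using assms(1) B
    by (intro exI[of _ "\<Union>(\<B> ` \<F>)"]) simp
qed

text \<open>Intersection distributes over finite unions, and basic sets intersect by pooling their
  conditions.\<close>

lemma semialgebraic_set_Int:
  assumes "semialgebraic_set S" "semialgebraic_set T"
  shows "semialgebraic_set (S \<inter> T)"
proof -
  obtain \<A> where A: "finite \<A>" "S = \<Union>\<A>" "\<forall>B\<in>\<A>. basic_semialgebraic_set B"
    using assms(1) unfolding semialgebraic_set_iff_basic by blast
  obtain \<B> where B: "finite \<B>" "T = \<Union>\<B>" "\<forall>B\<in>\<B>. basic_semialgebraic_set B"
    using assms(2) unfolding semialgebraic_set_iff_basic by blast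
  have "S \<inter> T = \<Union>((\<lambda>(C, D). C \<inter> D) ` (\<A> \<times> \<B>))" using A(2) B(2) by auto
  moreover have "\<forall>E\<in>(\<lambda>(C, D). C \<inter> D) ` (\<A> \<times> \<B>). basic_semialgebraic_set E"
    using A(3) B(3) basic_semialgebraic_set_Int by auto
  ultimately show ?thesis
    unfolding semialgebraic_set_iff_basic using A(1) B(1)
    by (intro exI[of _ "(\<lambda>(C, D). C \<inter> D) ` (\<A> \<times> \<B>)"]) simp
qed

lemma semialgebraic_set_Inter:
  assumes "finite \<F>" "\<And>S. S \<in> \<F> \<Longrightarrow> semialgebraic_set S"
  shows "semialgebraic_set (\<Inter>\<F>)"
  using assms
proof (induction \<F> rule: finite_induct)
  \<comment> \<open>The empty intersection is the whole space, the basic set with no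
    conditions.\<close>
  case empty
  show ?case
    using basic_imp_semialgebraic_set[OF basic_semialgebraic_setI[of "{}" "{}"]] by simp
qed (auto intro: semialgebraic_set_Int)

lemma semialgebraic_set_eq_0:
  "real_polynomial_function g \<Longrightarrow> semialgebraic_set {x. g x = 0}"
  using basic_imp_semialgebraic_set[OF basic_semialgebraic_setI[of "{g}" "{}"]] by simp

text \<open>Basic sets offer only equations and strict inequalities, so a weak inequality is split
  into the two cases.\<close>

lemma semialgebraic_set_ge_0:
  assumes "real_polynomial_function g"
  shows "semialgebraic_set {x. g x \<ge> 0}"
proof -
  have "semialgebraic_set (\<Union>{{x. g x = 0}, {x. g x > 0}})"
    using semialgebraic_set_eq_0[OF assms]
      basic_imp_semialgebraic_set[OF basic_semialgebraic_setI[of "{}" "{g}"]] assms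
    by (intro semialgebraic_set_Union) auto
  moreover have "\<Union>{{x. g x = 0}, {x. g x > 0}} = {x. g x \<ge> 0}" by auto
  ultimately show ?thesis by simp
qed

lemma real_polynomial_function_fst:
  "real_polynomial_function f \<Longrightarrow> real_polynomial_function (\<lambda>z. f (fst z))"
  using real_polynomial_function_compose[of fst f]
    polynomial_function_bounded_linear[OF bounded_linear_fst] by (simp add: o_def)

text \<open>The graph lives in the product with the real line, so the half-spaces that bound
  \<open>C\<close> are lifted to conditions on the first component.\<close>

lemma semialgebraic_set_polyhedron_cylinder:
  fixes C :: "'a::euclidean_space set"
  assumes "polyhedron C"
  shows "semialgebraic_set {z :: 'a \<times> real. fst z \<in> C}"
proof -
  obtain \<H> where H: "finite \<H>" "C = \<Inter>\<H>" "\<forall>h\<in>\<H>. \<exists>a b. a \<noteq> 0 \<and> h = {x. a \<bullet> x \<le> b}"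
    using assms unfolding polyhedron_def by blast
  have "semialgebraic_set {z :: 'a \<times> real. fst z \<in> h}" if "h \<in> \<H>" for h
  proof -
    obtain a b where h: "h = {x. a \<bullet> x \<le> b}" using H(3) \<open>h \<in> \<H>\<close> by blast
    have "real_polynomial_function (\<lambda>x. b - a \<bullet> x)"
      by (intro real_polynomial_function_diff real_polynomial_function.intros(1)
          real_polynomial_function.intros(2) bounded_linear_inner_right)
    from semialgebraic_set_ge_0[OF real_polynomial_function_fst[OF this]]
    show ?thesis by (simp add: h)
  qed
  then have "semialgebraic_set (\<Inter>((\<lambda>h. {z :: 'a \<times> real. fst z \<in> h}) ` \<H>))"
    using H(1) by (intro semialgebraic_set_Inter) auto
  moreover have "\<Inter>((\<lambda>h. {z :: 'a \<times> real. fst z \<in> h}) ` \<H>) = {z. fst z \<in> C}" using H(2) by auto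
  ultimately show ?thesis by simp
qed

lemma polynomial_deg_le_imp_real_polynomial_function:
  assumes "polynomial_deg_le d q" shows "real_polynomial_function q"
proof -
  obtain I a where I: "finite I" "\<And>x. q x = (\<Sum>m\<in>I. a m * (\<Prod>b\<in>Basis. (x \<bullet> b) ^ m b))"
    using assms unfolding polynomial_deg_le_def by blast
  have "real_polynomial_function (\<lambda>x. \<Sum>m\<in>I. a m * (\<Prod>b\<in>Basis. (x \<bullet> b) ^ m b))"
    by (intro real_polynomial_function_sum[OF I(1)] real_polynomial_function.intros(4)
        real_polynomial_function.intros(2) real_polynomial_function_prod finite_Basis
        real_polynomial_function_power real_polynomial_function.intros(1) bounded_linear_inner_left)
  then show ?thesis using I(2) by presburger
qed

text \<open>Over a piece \<open>C\<close> the graph is the cylinder over \<open>C\<close> cut by the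
  polynomial equation \<open>q x = r\<close>; finitely many such sets make up the graph.\<close>

lemma piecewise_linear_quadratic_imp_semialgebraic_fun:
  fixes h :: "'a::euclidean_space \<Rightarrow> ereal"
  assumes "piecewise_linear_quadratic h"
  shows "semialgebraic_fun h"
proof -
  obtain \<C> where C: "finite \<C>" "edom h = \<Union>\<C>"
    "\<forall>C\<in>\<C>. polyhedron C \<and> (\<exists>q. polynomial_deg_le 2 q \<and> (\<forall>x\<in>C. h x = ereal (q x)))"
    using assms unfolding piecewise_linear_quadratic_def by blast
  let ?piece = "\<lambda>C. {(x, r :: real). x \<in> C \<and> h x = ereal r}"
  have "semialgebraic_set (?piece C)" if CC: "C \<in> \<C>" for C
  proof -
    obtain q where q: "polynomial_deg_le 2 q" "\<forall>x\<in>C. h x = ereal (q x)" using C(3) CC by blast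
    have poly: "real_polynomial_function (\<lambda>z :: 'a \<times> real. q (fst z) - snd z)"
      by (rule real_polynomial_function_diff[OF real_polynomial_function_fst[OF
          polynomial_deg_le_imp_real_polynomial_function[OF q(1)]]
          real_polynomial_function.intros(1)[OF bounded_linear_snd]])
    have "?piece C = {z. fst z \<in> C} \<inter> {z. q (fst z) - snd z = 0}" using q(2) by auto
    moreover have "polyhedron C" using C(3) CC by blast
    ultimately show ?thesis
      using semialgebraic_set_Int[OF semialgebraic_set_polyhedron_cylinder
          semialgebraic_set_eq_0[OF poly]] by (simp only:)
  qed
  then have "semialgebraic_set (\<Union>(?piece ` \<C>))" using C(1) by (intro semialgebraic_set_Union) auto
  \<comment> \<open>Every point with a finite value lies in the effective domain, hence in some
    piece, so no part of the graph is missed.\<close>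
  moreover have "x \<in> \<Union>\<C>" if "h x = ereal r" for x r
    using that unfolding C(2)[symmetric] by (simp add: edom_def)
  then have "\<Union>(?piece ` \<C>) = {(x, r). h x = ereal r}" by auto
  ultimately show ?thesis unfolding semialgebraic_fun_def by simp
qed

section \<open>Value at risk\<close>

text \<open>The hypothesis gives point masses only. Their total over the finitely many scenario
  values is 1, so these values determine the probability of every Borel set.\<close>

lemma (in prob_space) prob_has_scenarios:
  fixes Z :: "'a \<Rightarrow> 'b::{second_countable_topology, t2_space}"
  assumes Z: "has_scenarios M Z S p v" and p: "(\<Sum>j\<in>{1..S}. p j) = 1"
    and A: "A \<in> sets borel"
  shows "prob {\<omega> \<in> space M. Z \<omega> \<in> A} = (\<Sum>j\<in>{j \<in> {1..S}. v j \<in> A}. p j)"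
proof -
  have [measurable]: "Z \<in> borel_measurable M" "A \<in> sets borel"
    and pt: "\<And>y. prob {\<omega> \<in> space M. Z \<omega> = y} = (\<Sum>j \<in> {j \<in> {1..S}. v j = y}. p j)"
    using Z A unfolding has_scenarios_def by auto
  define V where "V = v ` {1..S}"
  have fin: "prob {\<omega> \<in> space M. Z \<omega> \<in> F} = (\<Sum>j\<in>{j \<in> {1..S}. v j \<in> F}. p j)"
    if F: "F \<subseteq> V" for F
  proof -
    have "finite F" using F unfolding V_def by (rule finite_surj[rotated]) simp
    have "prob (\<Union>y\<in>F. {\<omega> \<in> space M. Z \<omega> = y}) = (\<Sum>y\<in>F. prob {\<omega> \<in> space M. Z \<omega> = y})"
      using \<open>finite F\<close> by (intro finite_measure_finite_Union) (auto simp: disjoint_family_on_def)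
    also have "(\<Union>y\<in>F. {\<omega> \<in> space M. Z \<omega> = y}) = {\<omega> \<in> space M. Z \<omega> \<in> F}" by auto
    \<comment> \<open>The scenario indices are grouped by value, so coinciding scenarios are counted
      with all their probabilities.\<close>
    also have "(\<Sum>y\<in>F. prob {\<omega> \<in> space M. Z \<omega> = y})
        = (\<Sum>y\<in>F. \<Sum>j\<in>{j \<in> {j \<in> {1..S}. v j \<in> F}. v j = y}. p j)"
      unfolding pt by (intro sum.cong) auto
    also have "\<dots> = (\<Sum>j\<in>{j \<in> {1..S}. v j \<in> F}. p j)"
      using \<open>finite F\<close> by (intro sum.group) auto
    finally show ?thesis .
  qed
  have [measurable]: "V \<in> sets borel"
    unfolding V_def by (intro borel_closed finite_imp_closed) simp
  have "{j \<in> {1..S}. v j \<in> V} = {1..S}" unfolding V_def by auto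
  then have "prob {\<omega> \<in> space M. Z \<omega> \<in> V} = 1" using fin[of V] p by simp
  \<comment> \<open>Almost sure membership in \<open>V\<close> allows an arbitrary Borel set
    \<open>A\<close> to be replaced by \<open>A \<inter> V\<close>, to which the finite case
    applies.\<close>
  then have "AE \<omega> in M. Z \<omega> \<in> V" by (subst (asm) prob_Collect_eq_1) auto
  then have "prob {\<omega> \<in> space M. Z \<omega> \<in> A} = prob {\<omega> \<in> space M. Z \<omega> \<in> A \<inter> V}"
    by (intro measure_eq_AE) auto
  also have "\<dots> = (\<Sum>j\<in>{j \<in> {1..S}. v j \<in> A}. p j)"
    by (subst fin) (auto simp: V_def intro!: sum.cong)
  finally show ?thesis .
qed

text \<open>The family consists of index sets and does not depend on the portfolio, so the minimum
  in the value at risk runs over a family fixed in advance.\<close>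

definition likely_scenario_sets :: "real \<Rightarrow> nat \<Rightarrow> (nat \<Rightarrow> real) \<Rightarrow> nat set set" where
  "likely_scenario_sets \<alpha> S p = {J. J \<subseteq> {1..S} \<and> \<alpha> \<le> (\<Sum>j\<in>J. p j)}"

lemma finite_likely_scenario_sets: "finite (likely_scenario_sets \<alpha> S p)"
  unfolding likely_scenario_sets_def by simp

text \<open>Positivity of \<alpha> excludes the empty set, so \<open>Max\<close> is always taken
  over a nonempty finite set.\<close>

lemma likely_scenario_sets_memberD:
  assumes "0 < \<alpha>" "J \<in> likely_scenario_sets \<alpha> S p"
  shows "finite J" "J \<noteq> {}"
  using assms finite_subset[of J "{1..S}"] by (auto simp: likely_scenario_sets_def)

lemma likely_scenario_sets_nonempty:
  assumes "\<alpha> < 1" "(\<Sum>j\<in>{1..S}. p j) = 1"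
  shows "likely_scenario_sets \<alpha> S p \<noteq> {}"
proof -
  have "{1..S} \<in> likely_scenario_sets \<alpha> S p" using assms by (simp add: likely_scenario_sets_def)
  then show ?thesis by blast
qed

text \<open>A level \<open>u\<close> is admissible for the value at risk exactly when the scenarios
  with loss at most \<open>u\<close> form a likely set. The least admissible level is therefore the
  smallest maximal loss over a likely set, and the infimum is attained.\<close>

lemma (in prob_space) VaR_eq_Min_Max:
  fixes Z :: "'a \<Rightarrow> 'b::euclidean_space"
  assumes Z: "has_scenarios M Z S p v" and p: "(\<Sum>j\<in>{1..S}. p j) = 1"
    and p0: "\<And>j. j \<in> {1..S} \<Longrightarrow> p j > 0" and \<alpha>: "0 < \<alpha>" "\<alpha> < 1"
  shows "VaR M \<alpha> (\<lambda>\<omega>. - (Z \<omega> \<bullet> y))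
    = Min ((\<lambda>J. Max ((\<lambda>j. - (v j \<bullet> y)) ` J)) ` likely_scenario_sets \<alpha> S p)"
proof -
  let ?l = "\<lambda>j. - (v j \<bullet> y)"
  let ?J = "\<lambda>u. {j \<in> {1..S}. ?l j \<le> u}"
  let ?m = "Min ((\<lambda>J. Max (?l ` J)) ` likely_scenario_sets \<alpha> S p)"
  have prob: "prob {\<omega> \<in> space M. - (Z \<omega> \<bullet> y) \<le> u} = (\<Sum>j\<in>?J u. p j)" for u
  proof -
    have "{z. - (z \<bullet> y) \<le> u} \<in> sets borel"
      by (intro borel_closed closed_Collect_le continuous_intros)
    from prob_has_scenarios[OF Z p this] show ?thesis by simp
  qed
  note ne = likely_scenario_sets_nonempty[OF \<alpha>(2) p]
  have "?m \<in> (\<lambda>J. Max (?l ` J)) ` likely_scenario_sets \<alpha> S p"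
    using finite_likely_scenario_sets ne by (intro Min_in) auto
  then obtain J where J: "J \<in> likely_scenario_sets \<alpha> S p" "?m = Max (?l ` J)" by blast
  \<comment> \<open>Every loss in the optimal \<open>J\<close> is at most \<open>?m\<close>; since
    probabilities are nonnegative, the larger set of all scenarios below \<open>?m\<close> is likely
    too.\<close>
  have sub: "J \<subseteq> ?J ?m"
    unfolding J(2) using J(1) likely_scenario_sets_memberD[OF \<alpha>(1) J(1)] by (auto simp: likely_scenario_sets_def)
  have "(\<Sum>j\<in>J. p j) \<le> (\<Sum>j\<in>?J ?m. p j)"
  proof (rule sum_mono2[OF _ sub])
    show "0 \<le> p b" if "b \<in> ?J ?m - J" for b using p0[of b] that by simp
  qed simp
  then have attained: "\<alpha> \<le> (\<Sum>j\<in>?J ?m. p j)" using J(1) by (auto simp: likely_scenario_sets_def)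
  \<comment> \<open>For an admissible \<open>u\<close> the sublevel set itself competes in the
    minimum, and its maximal loss is at most \<open>u\<close>.\<close>
  have lower: "?m \<le> u" if "\<alpha> \<le> (\<Sum>j\<in>?J u. p j)" for u
  proof -
    have Ju: "?J u \<in> likely_scenario_sets \<alpha> S p" using that by (auto simp: likely_scenario_sets_def)
    have "?m \<le> Max (?l ` ?J u)" using Ju finite_likely_scenario_sets by (intro Min_le) auto
    also have "\<dots> \<le> u" using likely_scenario_sets_memberD[OF \<alpha>(1) Ju] by (intro Max.boundedI) auto
    finally show ?thesis .
  qed
  show ?thesis
    unfolding VaR_def prob using attained lower by (intro cInf_eq_minimum) auto
qed

section \<open>Convex functions\<close>

lemma convex_on_max:
  fixes f g :: "'a::real_vector \<Rightarrow> real"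
  assumes f: "convex_on A f" and g: "convex_on A g"
  shows "convex_on A (\<lambda>x. max (f x) (g x))"
proof (rule convex_onI)
  fix t :: real and x y assume t: "0 < t" "t < 1" and xy: "x \<in> A" "y \<in> A"
  let ?m = "\<lambda>x. max (f x) (g x)"
  have "f ((1 - t) *\<^sub>R x + t *\<^sub>R y) \<le> (1 - t) * f x + t * f y"
    using convex_onD[OF f] t xy by simp
  also have "\<dots> \<le> (1 - t) * ?m x + t * ?m y" using t by (intro add_mono mult_left_mono) auto
  finally have 1: "f ((1 - t) *\<^sub>R x + t *\<^sub>R y) \<le> (1 - t) * ?m x + t * ?m y" .
  have "g ((1 - t) *\<^sub>R x + t *\<^sub>R y) \<le> (1 - t) * g x + t * g y"
    using convex_onD[OF g] t xy by simp
  also have "\<dots> \<le> (1 - t) * ?m x + t * ?m y" using t by (intro add_mono mult_left_mono) auto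
  finally show "?m ((1 - t) *\<^sub>R x + t *\<^sub>R y) \<le> (1 - t) * ?m x + t * ?m y" using 1 by simp
qed (rule convex_on_imp_convex[OF f])

lemma convex_on_Max:
  fixes f :: "'i \<Rightarrow> 'a::real_vector \<Rightarrow> real"
  assumes "finite I" "I \<noteq> {}" "\<And>i. i \<in> I \<Longrightarrow> convex_on A (f i)"
  shows "convex_on A (\<lambda>x. Max ((\<lambda>i. f i x) ` I))"
  using assms by (induction I rule: finite_ne_induct) (auto intro: convex_on_max)

lemma convex_on_sum_fun:
  fixes f :: "'i \<Rightarrow> 'a::real_vector \<Rightarrow> real"
  assumes "convex A" "\<And>i. i \<in> I \<Longrightarrow> convex_on A (f i)"
  shows "convex_on A (\<lambda>x. \<Sum>i\<in>I. f i x)"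
  using assms
  by (induction I rule: infinite_finite_induct) (auto simp: convex_on_const intro: convex_on_add)

lemma convex_on_linear:
  fixes g :: "'a::real_vector \<Rightarrow> real"
  assumes "linear g" "convex A"
  shows "convex_on A g"
  using assms by (intro convex_onI) (simp_all add: linear_add linear_scale)

lemma convex_on_abs_linear_diff:
  fixes f :: "'a::real_vector \<Rightarrow> real"
  assumes "linear f" "convex A"
  shows "convex_on A (\<lambda>x. \<bar>f x - b\<bar>)"
proof -
  have "convex_on A (\<lambda>x. max (f x + (- b)) (- f x + b))"
    using assms convex_on_linear[of f A] convex_on_linear[of "\<lambda>x. - f x" A]
      linear_compose_neg[of f] convex_on_const[of A]
    by (intro convex_on_max convex_on_add) simp_all
  moreover have "(\<lambda>x. max (f x + (- b)) (- f x + b)) = (\<lambda>x. \<bar>f x - b\<bar>)"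
    by (auto simp: max_def)
  ultimately show ?thesis by simp
qed

text \<open>The subtracted term is the exact gain over plain convexity, that is, the strong
  convexity of the squared norm.\<close>

lemma norm_square_convex_combination:
  fixes x y :: "'a::real_inner"
  shows "(norm ((1 - s) *\<^sub>R x + s *\<^sub>R y))\<^sup>2
    = (1 - s) * (norm x)\<^sup>2 + s * (norm y)\<^sup>2 - s * (1 - s) * (norm (y - x))\<^sup>2"
  unfolding power2_norm_eq_inner
  by (simp add: inner_add inner_diff inner_commute[of y x] algebra_simps)

section \<open>The Kurdyka--\L{}ojasiewicz inequality\<close>

text \<open>At points of \<open>X\<close> continuity of \<open>g\<close> gives the bound, and adding
  the indicator can only raise values. Off \<open>X\<close> the function is infinite on a whole
  neighbourhood, since \<open>X\<close> is closed.\<close>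

lemma closed_fun_add_indicator:
  fixes g :: "'a::euclidean_space \<Rightarrow> real"
  assumes "closed X" "continuous_on UNIV g"
  shows "closed_fun (\<lambda>x. ereal (g x) + indicator_fun X x)"
  unfolding closed_fun_def
proof (intro allI, unfold le_Liminf_iff, intro allI impI)
  fix x and u :: ereal
  assume u: "u < ereal (g x) + indicator_fun X x"
  show "eventually (\<lambda>y. u < ereal (g y) + indicator_fun X y) (at x)"
  proof (cases "x \<in> X")
    case True
    have "((\<lambda>y. ereal (g y)) \<longlongrightarrow> ereal (g x)) (at x)"
      using assms(2) by (simp add: continuous_on_def)
    moreover have "u < ereal (g x)" using u True by (simp add: indicator_fun_def)
    ultimately have "eventually (\<lambda>y. u < ereal (g y)) (at x)" by (rule order_tendstoD)
    then show ?thesis by eventually_elim (auto simp: indicator_fun_def)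
  next
    case False
    then have "eventually (\<lambda>y. y \<in> - X) (at x)"
      using assms(1) by (intro eventually_at_in_open') auto
    moreover have "u < \<infinity>" using u False by (simp add: indicator_fun_def)
    ultimately show ?thesis by (auto elim!: eventually_mono simp: indicator_fun_def)
  qed
qed

text \<open>Along the segment from \<open>x\<close> to \<open>z\<close>, the Frechet inequality bounds \<open>\<Phi>\<close> from below, while the
  strongly convex majorant \<open>G + k \<parallel>\<cdot>\<parallel>\<^sup>2\<close> that touches \<open>\<Phi>\<close> at \<open>x\<close> bounds it from above.\<close>

lemma frechet_subdiff_majorant:
  fixes \<Phi> G :: "'a::euclidean_space \<Rightarrow> real" and X :: "'a set"
  defines "\<Psi> \<equiv> \<lambda>x. ereal (\<Phi> x) + indicator_fun X x"
  assumes X: "convex X" "x \<in> X" "z \<in> X" and k: "k > 0"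
    and G: "convex_on X G"
    and major: "\<And>y. y \<in> X \<Longrightarrow> \<Phi> y \<le> G y + k * (norm y)\<^sup>2"
    and touch: "\<Phi> x = G x + k * (norm x)\<^sup>2"
    and u: "u \<in> frechet_subdiff \<Psi> x"
  shows "\<Phi> x - (G z + k * (norm z)\<^sup>2) \<le> (norm u)\<^sup>2 / (4 * k)"
proof (cases "z = x")
  case True
  then show ?thesis using touch k by simp
next
  case False
  define d where "d = z - x"
  define D where "D = norm d"
  have "D > 0" unfolding D_def d_def using False by simp
  let ?H = "\<lambda>y. G y + k * (norm y)\<^sup>2"
  have lim: "0 \<le> Liminf (at x) (\<lambda>y. (\<Psi> y - \<Psi> x - ereal (u \<bullet> (y - x))) / ereal (norm (y - x)))"
    using u unfolding frechet_subdiff_def by blast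
  \<comment> \<open>The liminf condition is used with a slack \<open>e\<close> that is sent to 0
    afterwards.\<close>
  have approx: "\<Phi> x - ?H z + u \<bullet> d + k * D\<^sup>2 \<le> e * (D + k * D\<^sup>2)" if e: "0 < e" "e < 1" for e
  proof -
    have "eventually (\<lambda>y. ereal (- e) < (\<Psi> y - \<Psi> x - ereal (u \<bullet> (y - x))) / ereal (norm (y - x))) (at x)"
      using lim e unfolding le_Liminf_iff by simp
    then obtain \<delta> where "\<delta> > 0" and \<delta>: "\<And>y. y \<noteq> x \<Longrightarrow> dist y x < \<delta> \<Longrightarrow>
        ereal (- e) < (\<Psi> y - \<Psi> x - ereal (u \<bullet> (y - x))) / ereal (norm (y - x))"
      unfolding eventually_at by blast
    \<comment> \<open>The bound \<open>\<delta> / (2 * D)\<close> keeps \<open>y\<close> within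
      distance \<delta> of \<open>x\<close>; the bound \<open>e\<close> lets the second-order
      remainder \<open>s * (k * D\<^sup>2)\<close> be absorbed into the slack, and
      \<open>e < 1\<close> makes the combination convex.\<close>
    define s where "s = min e (\<delta> / (2 * D))"
    have s: "0 < s" "s \<le> e" "s < 1" using e \<open>\<delta> > 0\<close> \<open>D > 0\<close> unfolding s_def by auto
    have "s * D \<le> \<delta> / (2 * D) * D" unfolding s_def using \<open>D > 0\<close> by (intro mult_right_mono) auto
    then have "s * D < \<delta>" using \<open>\<delta> > 0\<close> \<open>D > 0\<close> by simp
    define y where "y = (1 - s) *\<^sub>R x + s *\<^sub>R z"
    have yx: "y - x = s *\<^sub>R d" unfolding y_def d_def by (simp add: algebra_simps)
    then have nyx: "norm (y - x) = s * D" using s by (simp add: D_def)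
    have "y \<in> X" unfolding y_def using X s by (intro convexD) auto
    have "y \<noteq> x" using nyx s \<open>D > 0\<close> by auto
    then have "ereal (- e) < (\<Psi> y - \<Psi> x - ereal (u \<bullet> (y - x))) / ereal (norm (y - x))"
      using \<open>s * D < \<delta>\<close> nyx by (intro \<delta>) (simp_all add: dist_norm)
    \<comment> \<open>Both \<open>x\<close> and \<open>y\<close> lie in \<open>X\<close>, so the
      quotient of extended reals is a real quotient.\<close>
    also have "\<dots> = ereal ((\<Phi> y - \<Phi> x - u \<bullet> (y - x)) / (s * D))"
      using \<open>y \<in> X\<close> X(2) s \<open>D > 0\<close> unfolding \<Psi>_def nyx
      by (simp add: indicator_fun_def)
    also have "u \<bullet> (y - x) = s * (u \<bullet> d)" by (simp add: yx)
    finally have "- e * (s * D) < \<Phi> y - \<Phi> x - s * (u \<bullet> d)"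
      using s \<open>D > 0\<close> by (simp add: pos_less_divide_eq)
    also have "\<Phi> y \<le> ?H y" using major \<open>y \<in> X\<close> by blast
    also have "?H y \<le> (1 - s) * ?H x + s * ?H z - s * (1 - s) * k * D\<^sup>2"
    proof -
      have "G y \<le> (1 - s) * G x + s * G z"
        unfolding y_def using convex_onD[OF G] s X by simp
      moreover have ny: "(norm y)\<^sup>2 = (1 - s) * (norm x)\<^sup>2 + s * (norm z)\<^sup>2 - s * (1 - s) * D\<^sup>2"
        unfolding y_def D_def d_def by (rule norm_square_convex_combination)
      ultimately show ?thesis unfolding ny by (simp add: algebra_simps)
    qed
    finally have "0 < s * (e * D + ?H z - \<Phi> x - u \<bullet> d - (1 - s) * k * D\<^sup>2)"
      unfolding touch by (simp add: algebra_simps)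
    then have "0 < e * D + ?H z - \<Phi> x - u \<bullet> d - (1 - s) * k * D\<^sup>2"
      using s by (simp only: zero_less_mult_pos)
    then have "\<Phi> x - ?H z + u \<bullet> d + k * D\<^sup>2 \<le> e * D + s * (k * D\<^sup>2)"
      by (simp add: algebra_simps)
    also have "\<dots> \<le> e * D + e * (k * D\<^sup>2)" using s k by (intro add_left_mono mult_right_mono) auto
    finally show ?thesis by (simp add: algebra_simps)
  qed
  have "\<Phi> x - ?H z + u \<bullet> d + k * D\<^sup>2 \<le> 0"
  proof (rule tendsto_lowerbound)
    show "((\<lambda>e. e * (D + k * D\<^sup>2)) \<longlongrightarrow> 0) (at_right 0)"
      by (rule tendsto_eq_intros refl | simp)+
    show "eventually (\<lambda>e. \<Phi> x - ?H z + u \<bullet> d + k * D\<^sup>2 \<le> e * (D + k * D\<^sup>2)) (at_right 0)"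
      using approx by (intro eventually_at_rightI[of 0 1]) auto
  qed simp
  moreover have "- (norm u * D) \<le> u \<bullet> d"
    using Cauchy_Schwarz_ineq2[of u d] unfolding D_def by linarith
  \<comment> \<open>Completing the square: the left side is largest at
    \<open>D = norm u / (2 * k)\<close>, which is where the factor \<open>4 * k\<close> comes
    from.\<close>
  moreover have "norm u * D - k * D\<^sup>2 \<le> (norm u)\<^sup>2 / (4 * k)"
  proof -
    have "0 \<le> (norm u - 2 * k * D)\<^sup>2" by simp
    then show ?thesis using k by (simp add: field_simps power2_eq_square)
  qed
  ultimately show ?thesis by linarith
qed

text \<open>A majorant that touches \<open>\<Phi>\<close> at some \<open>x\<close> near \<open>z\<close> also touches \<open>\<Phi>\<close> at \<open>z\<close>, by continuity and
  because there are finitely many; the previous lemma then applies to it.\<close>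

lemma frechet_subdiff_min_strongly_convex:
  fixes \<Phi> :: "'a::euclidean_space \<Rightarrow> real" and G :: "'i \<Rightarrow> 'a \<Rightarrow> real" and X :: "'a set"
  defines "\<Psi> \<equiv> \<lambda>x. ereal (\<Phi> x) + indicator_fun X x"
  assumes X: "convex X" "z \<in> X" and k: "k > 0" and K: "finite K"
    and G: "\<And>i. i \<in> K \<Longrightarrow> convex_on X (G i)" "\<And>i. i \<in> K \<Longrightarrow> continuous_on UNIV (G i)"
    and major: "\<And>i y. i \<in> K \<Longrightarrow> y \<in> X \<Longrightarrow> \<Phi> y \<le> G i y + k * (norm y)\<^sup>2"
    and touch: "\<And>y. y \<in> X \<Longrightarrow> \<exists>i\<in>K. \<Phi> y = G i y + k * (norm y)\<^sup>2"
    and cont: "continuous_on UNIV \<Phi>"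
  shows "\<exists>\<epsilon>>0. \<forall>x\<in>X. norm (x - z) < \<epsilon> \<longrightarrow>
    (\<forall>u \<in> frechet_subdiff \<Psi> x. \<Phi> x - \<Phi> z \<le> (norm u)\<^sup>2 / (4 * k))"
proof -
  let ?H = "\<lambda>i y. G i y + k * (norm y)\<^sup>2"
  \<comment> \<open>Only the majorants strictly above \<Phi> at \<open>z\<close> are considered;
    finiteness gives one neighbourhood on which all of them stay strictly above.\<close>
  have "eventually (\<lambda>x. \<forall>i\<in>{i \<in> K. \<Phi> z < ?H i z}. \<Phi> x < ?H i x) (nhds z)"
  proof (intro eventually_ball_finite ballI)
    fix i assume i: "i \<in> {i \<in> K. \<Phi> z < ?H i z}"
    then have "continuous_on UNIV (\<lambda>x. ?H i x - \<Phi> x)"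
      using G(2) cont by (intro continuous_intros) auto
    then have "((\<lambda>x. ?H i x - \<Phi> x) \<longlongrightarrow> ?H i z - \<Phi> z) (nhds z)"
      by (simp add: continuous_on_def tendsto_nhds_iff)
    then have "eventually (\<lambda>x. 0 < ?H i x - \<Phi> x) (nhds z)"
      using i by (elim order_tendstoD) simp
    then show "eventually (\<lambda>x. \<Phi> x < ?H i x) (nhds z)" by eventually_elim simp
  qed (use K in simp)
  then obtain \<epsilon> where "\<epsilon> > 0" and \<epsilon>: "\<And>x i. dist x z < \<epsilon> \<Longrightarrow> i \<in> K \<Longrightarrow> \<Phi> z < ?H i z \<Longrightarrow> \<Phi> x < ?H i x"
    unfolding eventually_nhds_metric by blast
  show ?thesis
  proof (intro exI[of _ \<epsilon>] conjI ballI impI \<open>\<epsilon> > 0\<close>)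
    fix x u assume x: "x \<in> X" "norm (x - z) < \<epsilon>" and u: "u \<in> frechet_subdiff \<Psi> x"
    obtain i where i: "i \<in> K" "\<Phi> x = ?H i x" using touch x(1) by blast
    have "\<not> \<Phi> z < ?H i z" using \<epsilon>[of x i] x(2) i by (auto simp: dist_norm)
    then have "?H i z \<le> \<Phi> z" by simp
    moreover have "\<Phi> x - ?H i z \<le> (norm u)\<^sup>2 / (4 * k)"
      using X x(1) k G(1)[OF i(1)] major[OF i(1)] i(2) u unfolding \<Psi>_def
      by (intro frechet_subdiff_majorant)
    ultimately show "\<Phi> x - \<Phi> z \<le> (norm u)\<^sup>2 / (4 * k)" by linarith
  qed
qed

text \<open>The estimate for Frechet subgradients survives limits because \<Phi> is continuous and
  the ball around \<open>z\<close> is open; taking square roots then gives the exponent 1/2.\<close>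

lemma KL_property_at_half:
  fixes \<Phi> :: "'a::euclidean_space \<Rightarrow> real" and X :: "'a set"
  defines "\<Psi> \<equiv> \<lambda>x. ereal (\<Phi> x) + indicator_fun X x"
  assumes proper: "proper_fun \<Psi>" and closed: "closed_fun \<Psi>" and z: "z \<in> dom_subdiff \<Psi>"
    and k: "k > 0" and "\<epsilon> > 0"
    and frechet: "\<And>x u. x \<in> X \<Longrightarrow> norm (x - z) < \<epsilon> \<Longrightarrow> u \<in> frechet_subdiff \<Psi> x \<Longrightarrow>
      \<Phi> x - \<Phi> z \<le> (norm u)\<^sup>2 / (4 * k)"
    and cont: "continuous_on UNIV \<Phi>"
  shows "KL_property_at \<Psi> (1/2) z"
proof -
  have finX: "y \<in> X" if "\<bar>\<Psi> y\<bar> \<noteq> \<infinity>" for y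
    using that unfolding \<Psi>_def indicator_fun_def by (auto split: if_splits)
  have on_X: "\<Psi> y = ereal (\<Phi> y)" if "y \<in> X" for y
    using that by (simp add: \<Psi>_def indicator_fun_def)
  have lim_finite: "\<bar>\<Psi> y\<bar> \<noteq> \<infinity>" if "u \<in> limiting_subdiff \<Psi> y" for y u
    using that unfolding limiting_subdiff_def by (elim CollectE conjE)
  have frechet_finite: "\<bar>\<Psi> y\<bar> \<noteq> \<infinity>" if "u \<in> frechet_subdiff \<Psi> y" for y u
    using that unfolding frechet_subdiff_def by (elim CollectE conjE)
  obtain u0 where "u0 \<in> limiting_subdiff \<Psi> z" using z unfolding dom_subdiff_def by blast
  then have "z \<in> X" by (intro finX lim_finite)
  have limiting: "\<Phi> x - \<Phi> z \<le> (norm u)\<^sup>2 / (4 * k)"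
    if x: "norm (x - z) < \<epsilon>" and u: "u \<in> limiting_subdiff \<Psi> x" for x u
  proof -
    obtain Y V where "Y \<longlonglongrightarrow> x" "V \<longlonglongrightarrow> u" "\<forall>j::nat. V j \<in> frechet_subdiff \<Psi> (Y j)"
      using u unfolding limiting_subdiff_def by (elim CollectE conjE exE) (rule that)
    then have Y: "Y \<longlonglongrightarrow> x" "V \<longlonglongrightarrow> u" "\<And>j. V j \<in> frechet_subdiff \<Psi> (Y j)" by simp_all
    have YX: "Y j \<in> X" for j by (intro finX frechet_finite) (rule Y(3))
    have "(\<lambda>j. norm (Y j - z)) \<longlonglongrightarrow> norm (x - z)" using Y(1) by (intro tendsto_intros)
    \<comment> \<open>The ball is open, so the tail of the approximating sequence lies in it and the
      Frechet estimate is available there.\<close>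
    then have "eventually (\<lambda>j. norm (Y j - z) < \<epsilon>) sequentially" using x by (rule order_tendstoD)
    then have "eventually (\<lambda>j. \<Phi> (Y j) - \<Phi> z \<le> (norm (V j))\<^sup>2 / (4 * k)) sequentially"
      by eventually_elim (rule frechet[OF YX _ Y(3)])
    moreover have "(\<lambda>j. \<Phi> (Y j)) \<longlonglongrightarrow> \<Phi> x"
      using cont Y(1) by (rule continuous_on_tendsto_compose) auto
    then have "(\<lambda>j. \<Phi> (Y j) - \<Phi> z) \<longlonglongrightarrow> \<Phi> x - \<Phi> z" by (intro tendsto_intros)
    moreover have "(\<lambda>j. (norm (V j))\<^sup>2 / (4 * k)) \<longlonglongrightarrow> (norm u)\<^sup>2 / (4 * k)"
      using Y(2) k by (intro tendsto_intros) auto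
    ultimately show ?thesis by (intro tendsto_le[OF sequentially_bot]) auto
  qed
  \<comment> \<open>The constant \<open>2 * sqrt k\<close> is the square root of the factor
    \<open>4 * k\<close> in the estimate. The bound is proved for each subgradient, which also
    covers an empty subdifferential, whose infimum is infinite.\<close>
  have "ereal (2 * sqrt k * (real_of_ereal (\<Psi> x) - real_of_ereal (\<Psi> z)) powr (1/2))
      \<le> edist_set 0 (limiting_subdiff \<Psi> x)"
    if x: "norm (x - z) < \<epsilon>" "\<Psi> z < \<Psi> x" "\<Psi> x < \<Psi> z + ereal 1" for x
    unfolding edist_set_def
  proof (rule INF_greatest)
    fix u assume u: "u \<in> limiting_subdiff \<Psi> x"
    have "x \<in> X" using u by (intro finX lim_finite)
    then have "\<Phi> z < \<Phi> x" using x(2) on_X \<open>z \<in> X\<close> by simp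
    have "4 * k * (\<Phi> x - \<Phi> z) \<le> (norm u)\<^sup>2"
      using limiting[OF x(1) u] k by (simp add: field_simps)
    then have "sqrt (4 * k * (\<Phi> x - \<Phi> z)) \<le> norm u" by (rule real_le_lsqrt[rotated -1]) simp
    then have "2 * sqrt k * (\<Phi> x - \<Phi> z) powr (1/2) \<le> norm u"
      using \<open>\<Phi> z < \<Phi> x\<close> by (simp add: powr_half_sqrt real_sqrt_mult)
    then show "ereal (2 * sqrt k * (real_of_ereal (\<Psi> x) - real_of_ereal (\<Psi> z)) powr (1/2))
        \<le> ereal (dist 0 u)"
      using on_X \<open>x \<in> X\<close> \<open>z \<in> X\<close> by simp
  qed
  moreover have "2 * sqrt k > 0" using k by simp
  ultimately show ?thesis
    unfolding KL_property_at_def using proper closed z \<open>\<epsilon> > 0\<close>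
    by (intro conjI exI[of _ "2 * sqrt k"] exI[of _ \<epsilon>] exI[of _ 1]) auto
qed

section \<open>The portfolio model\<close>

text \<open>One hyperplane per period and one half-space per period and asset, hence finitely
  many.\<close>

lemma polyhedron_feasible_set: "polyhedron (feasible_set :: (real^'n^'t) set)"
proof -
  have le: "polyhedron {x. 0 \<le> g x}" and eq: "polyhedron {x. g x = b}"
    if g: "linear g" for g :: "real^'n^'t \<Rightarrow> real" and b
  proof -
    obtain a where a: "\<And>x. g x = a \<bullet> x" using linear_functional_eq_inner[OF g] by blast
    show "polyhedron {x. 0 \<le> g x}" unfolding a by (rule polyhedron_halfspace_ge)
    show "polyhedron {x. g x = b}" unfolding a by (rule polyhedron_hyperplane)
  qed
  let ?E = "\<lambda>t. {x :: real^'n^'t. (\<Sum>i\<in>UNIV. x $ t $ i) = 1}"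
  let ?I = "\<lambda>(t, i). {x :: real^'n^'t. 0 \<le> x $ t $ i}"
  have "polyhedron (\<Inter>(range ?E) \<inter> \<Inter>(range ?I))"
  proof (intro polyhedron_Int polyhedron_Inter)
    fix H assume "H \<in> range ?E"
    then obtain t where "H = ?E t" by blast
    moreover have "linear (\<lambda>x :: real^'n^'t. \<Sum>i\<in>UNIV. x $ t $ i)"
      by (intro linearI) (simp_all add: sum.distrib sum_distrib_left)
    ultimately show "polyhedron H" using eq by simp
  next
    fix H assume "H \<in> range ?I"
    then obtain t i where "H = {x. 0 \<le> x $ t $ i}" by auto
    moreover have "linear (\<lambda>x :: real^'n^'t. x $ t $ i)" by (intro linearI) simp_all
    ultimately show "polyhedron H" using le by simp
  qed simp_all
  also have "\<Inter>(range ?E) \<inter> \<Inter>(range ?I) = feasible_set"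
    by (auto simp: feasible_set_def unit_simplex_def)
  finally show ?thesis .
qed

section \<open>The objective as a convex piecewise affine part plus a multiple of the squared
  norm\<close>

definition trading_objective ::
  "('t \<Rightarrow> real^'n) \<Rightarrow> ('n \<Rightarrow> real) \<Rightarrow> real^'n \<Rightarrow> real \<Rightarrow> real^'n^('t::{finite,linorder}) \<Rightarrow> real" where
  "trading_objective \<mu> c w lam1 = objective \<mu> c w lam1 0"

text \<open>The block norms add up to the norm of the whole vector, so the quadratic term has the
  form \<open>k * (norm x)\<^sup>2\<close> with \<open>k = lam2\<close>.\<close>

lemma objective_eq_trading_objective:
  "objective \<mu> c w lam1 lam2 x = trading_objective \<mu> c w lam1 x + lam2 * (norm x)\<^sup>2"
proof -
  have "(norm x)\<^sup>2 = (\<Sum>t\<in>UNIV. (norm (x $ t))\<^sup>2)"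
    by (simp add: power2_norm_eq_inner inner_vec_def[of x])
  then show ?thesis by (simp add: trading_objective_def objective_def)
qed

lemma linear_component:
  fixes t s :: "'t::finite" and i :: "'n::finite"
  shows "linear (\<lambda>x :: real^'n^'t. x $ t $ i)" "linear (\<lambda>x :: real^'n^'t. x $ t $ i - x $ s $ i)"
  by (intro linearI; simp add: algebra_simps)+

lemma linear_inner_component:
  "linear (\<lambda>x :: (real^'n)^'t::finite. a \<bullet> x $ t)"
  by (intro linearI) (simp_all add: inner_add_right)

lemma convex_on_trading_objective:
  fixes \<mu> :: "'t::{finite,linorder} \<Rightarrow> real^'n"
  assumes "lam1 \<ge> 0" "\<And>i. c i \<ge> 0"
  shows "convex_on UNIV (trading_objective \<mu> c w lam1)"
proof -
  have "linear (\<lambda>x :: real^'n^('t::{finite,linorder}). - (\<Sum>t\<in>UNIV. \<mu> t \<bullet> x $ t))"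
    by (intro linear_compose_neg linear_compose_sum) (simp add: linear_inner_component)
  then have "convex_on UNIV (\<lambda>x :: real^'n^('t::{finite,linorder}). - (\<Sum>t\<in>UNIV. \<mu> t \<bullet> x $ t))"
    by (rule convex_on_linear) simp
  moreover have "convex_on UNIV (\<lambda>x :: real^'n^('t::{finite,linorder}). c i * \<bar>x $ first_period $ i - w $ i\<bar>)" for i
    using assms(2) by (intro convex_on_cmul convex_on_abs_linear_diff linear_component) auto
  moreover have "convex_on UNIV (\<lambda>x :: real^'n^('t::{finite,linorder}). c i * \<bar>x $ t $ i - x $ prev_period t $ i\<bar>)" for t i
    \<comment> \<open>The difference of two consecutive blocks is itself linear in \<open>x\<close>,
      hence the offset 0.\<close>
    using convex_on_abs_linear_diff[OF linear_component(2)[of t i "prev_period t"], of UNIV 0] assms(2)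
    by (intro convex_on_cmul) auto
  ultimately show ?thesis
    unfolding trading_objective_def objective_def mult_zero_left add_0_right
    using assms(1) by (intro convex_on_add convex_on_cmul[of lam1] convex_on_sum_fun) simp_all
qed

lemma piecewise_affine_trading_objective: "piecewise_affine (trading_objective \<mu> c w lam1)"
  unfolding trading_objective_def objective_def mult_zero_left add_0_right
  by (intro piecewise_affine_add piecewise_affine_diff piecewise_affine_cmul piecewise_affine_sum
      piecewise_affine_abs piecewise_affine_minus piecewise_affine_const
      piecewise_affine_linear[OF linear_inner_component]
      piecewise_affine_linear[OF linear_component(1)])

section \<open>The risk penalty as a minimum of convex piecewise affine functions\<close>

definition scenario_risk ::
  "real \<Rightarrow> ('t::finite \<Rightarrow> nat \<Rightarrow> real^'n) \<Rightarrow> ('t \<Rightarrow> nat set) \<Rightarrow> real^'n^'t \<Rightarrow> real" where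
  "scenario_risk \<tau> v J x = (\<Sum>t\<in>UNIV. max (Max ((\<lambda>j. - (v t j \<bullet> x $ t)) ` J t) - \<tau>) 0)"

lemma linear_scenario_loss: "linear (\<lambda>x :: (real^'n)^'t::finite. - (a \<bullet> x $ t))"
  by (intro linear_compose_neg linear_inner_component)

text \<open>Fixing one scenario set per period removes the minimum from the value at risk; maxima,
  shifts, positive parts and sums of convex functions remain.\<close>

lemma convex_on_scenario_risk:
  fixes v :: "'t::finite \<Rightarrow> nat \<Rightarrow> real^'n"
  assumes "\<And>t. finite (J t)" "\<And>t. J t \<noteq> {}"
  shows "convex_on UNIV (scenario_risk \<tau> v J)"
proof -
  have "convex_on UNIV (\<lambda>x :: real^'n^'t. Max ((\<lambda>j. - (v t j \<bullet> x $ t)) ` J t))" for t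
    using assms by (intro convex_on_Max convex_on_linear linear_scenario_loss) simp_all
  then have "convex_on UNIV (\<lambda>x :: real^'n^'t. Max ((\<lambda>j. - (v t j \<bullet> x $ t)) ` J t) + (- \<tau>))" for t
    by (rule convex_on_add) (simp add: convex_on_const)
  then show ?thesis
    unfolding scenario_risk_def
    by (intro convex_on_sum_fun convex_on_max) (simp_all add: convex_on_const)
qed

lemma piecewise_affine_scenario_risk:
  assumes "\<And>t. finite (J t)" "\<And>t. J t \<noteq> {}"
  shows "piecewise_affine (scenario_risk \<tau> v J)"
  unfolding scenario_risk_def using assms
  by (intro piecewise_affine_sum piecewise_affine_positive_part piecewise_affine_diff
      piecewise_affine_Max piecewise_affine_const piecewise_affine_linear linear_scenario_loss)

text \<open>Unlike convexity, piecewise affinity survives the minimum over the likely sets.\<close>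

lemma piecewise_affine_risk_penalty:
  fixes \<xi> :: "'t::finite \<Rightarrow> 'w \<Rightarrow> real^'n"
  assumes VaR: "\<And>t y. VaR M \<alpha> (\<lambda>\<omega>. - (\<xi> t \<omega> \<bullet> y))
      = Min ((\<lambda>J. Max ((\<lambda>j. - (v t j \<bullet> y)) ` J)) ` L t)"
    and L: "\<And>t. finite (L t)" "\<And>t. L t \<noteq> {}"
      "\<And>t J. J \<in> L t \<Longrightarrow> finite J" "\<And>t J. J \<in> L t \<Longrightarrow> J \<noteq> {}"
  shows "piecewise_affine (risk_penalty M \<alpha> \<tau> \<xi>)"
  unfolding risk_penalty_def VaR using L
  by (intro piecewise_affine_sum piecewise_affine_positive_part piecewise_affine_diff
      piecewise_affine_Min piecewise_affine_Max piecewise_affine_const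
      piecewise_affine_linear linear_scenario_loss)

text \<open>Each \<open>J t\<close> competes in the minimum that defines the value at risk, and
  positive part and sum are monotone.\<close>

lemma risk_penalty_le_scenario_risk:
  assumes VaR: "\<And>t y. VaR M \<alpha> (\<lambda>\<omega>. - (\<xi> t \<omega> \<bullet> y))
      = Min ((\<lambda>J. Max ((\<lambda>j. - (v t j \<bullet> y)) ` J)) ` L t)"
    and L: "\<And>t. finite (L t)" "\<And>t. J t \<in> L t"
  shows "risk_penalty M \<alpha> \<tau> \<xi> x \<le> scenario_risk \<tau> v J x"
proof -
  have "VaR M \<alpha> (\<lambda>\<omega>. - (\<xi> t \<omega> \<bullet> x $ t)) \<le> Max ((\<lambda>j. - (v t j \<bullet> x $ t)) ` J t)" for t
    unfolding VaR using L by (intro Min_le) auto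
  then show ?thesis
    unfolding risk_penalty_def scenario_risk_def by (intro sum_mono max.mono diff_right_mono) auto
qed

text \<open>The minima of the separate periods are attained independently, so a single choice
  function \<open>J\<close> collects a minimizer for each period.\<close>

lemma risk_penalty_eq_scenario_risk:
  assumes VaR: "\<And>t y. VaR M \<alpha> (\<lambda>\<omega>. - (\<xi> t \<omega> \<bullet> y))
      = Min ((\<lambda>J. Max ((\<lambda>j. - (v t j \<bullet> y)) ` J)) ` L t)"
    and L: "\<And>t. finite (L t)" "\<And>t. L t \<noteq> {}"
  obtains J where "\<And>t. J t \<in> L t" "risk_penalty M \<alpha> \<tau> \<xi> x = scenario_risk \<tau> v J x"
proof -
  have "\<exists>J \<in> L t. VaR M \<alpha> (\<lambda>\<omega>. - (\<xi> t \<omega> \<bullet> x $ t)) = Max ((\<lambda>j. - (v t j \<bullet> x $ t)) ` J)" for t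
  proof -
    have "VaR M \<alpha> (\<lambda>\<omega>. - (\<xi> t \<omega> \<bullet> x $ t)) \<in> (\<lambda>J. Max ((\<lambda>j. - (v t j \<bullet> x $ t)) ` J)) ` L t"
      unfolding VaR using L by (intro Min_in) auto
    then show ?thesis by blast
  qed
  then obtain J where "\<And>t. J t \<in> L t"
    "\<And>t. VaR M \<alpha> (\<lambda>\<omega>. - (\<xi> t \<omega> \<bullet> x $ t)) = Max ((\<lambda>j. - (v t j \<bullet> x $ t)) ` J t)"
    by metis
  then show thesis
    by (intro that[of J]) (simp_all add: risk_penalty_def scenario_risk_def)
qed

section \<open>Application to the portfolio functional\<close>

theorem proposition4p4:
  fixes M :: "'w measure"
    and \<xi> :: "'t::{finite,linorder} \<Rightarrow> 'w \<Rightarrow> real^'n"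
    and S :: "'t \<Rightarrow> nat"
    and p :: "'t \<Rightarrow> nat \<Rightarrow> real"
    and v :: "'t \<Rightarrow> nat \<Rightarrow> real^'n"
    and w_prev :: "real^'n"
    and c :: "'n \<Rightarrow> real"
    and \<alpha> lam1 lam2 \<tau> \<rho> :: real
    and \<mu> :: "'t \<Rightarrow> real^'n"
    and f R \<Phi> :: "real^'n^('t::{finite,linorder}) \<Rightarrow> real"
    and \<Psi> :: "real^'n^('t::{finite,linorder}) \<Rightarrow> ereal"
  assumes "prob_space M"
    and "\<And>t. S t \<ge> 1"
    and "\<And>t j. j \<in> {1..S t} \<Longrightarrow> p t j > 0"
    and "\<And>t. (\<Sum>j\<in>{1..S t}. p t j) = 1"
    and "\<And>t. has_scenarios M (\<xi> t) (S t) (p t) (v t)"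
    and "w_prev \<in> unit_simplex"
    and "0 < \<alpha>" "\<alpha> < 1"
    and "lam1 > 0" "lam2 > 0"
    and "\<And>i. c i \<ge> 0"
    and "\<rho> > 0"
  defines "\<mu> \<equiv> \<lambda>t. scenario_mean (S t) (p t) (v t)"
    and "f \<equiv> objective \<mu> c w_prev lam1 lam2"
    and "R \<equiv> risk_penalty M \<alpha> \<tau> \<xi>"
    and "\<Phi> \<equiv> \<lambda>x. f x + \<rho> * R x"
    and "\<Psi> \<equiv> \<lambda>x. ereal (\<Phi> x) + indicator_fun feasible_set x"
  shows "proper_fun \<Psi> \<and> closed_fun \<Psi> \<and> piecewise_linear_quadratic \<Psi> \<and>
         semialgebraic_fun \<Psi> \<and> (\<forall>x \<in> dom_subdiff \<Psi>. KL_property_at \<Psi> (1/2) x)"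
proof -
  interpret prob_space M by fact
  let ?X = "feasible_set :: (real^'n^('t::{finite,linorder})) set"
  let ?T = "trading_objective \<mu> c w_prev lam1"
  define L where "L t = likely_scenario_sets \<alpha> (S t) (p t)" for t
  have VaR: "VaR M \<alpha> (\<lambda>\<omega>. - (\<xi> t \<omega> \<bullet> y)) = Min ((\<lambda>J. Max ((\<lambda>j. - (v t j \<bullet> y)) ` J)) ` L t)" for t y
    unfolding L_def by (rule VaR_eq_Min_Max) (fact assms)+
  have L: "finite (L t)" "L t \<noteq> {}" for t
    unfolding L_def by (rule finite_likely_scenario_sets, rule likely_scenario_sets_nonempty) (fact assms)+
  have LJ: "finite J" "J \<noteq> {}" if "J \<in> L t" for t J
    using that likely_scenario_sets_memberD[OF \<open>0 < \<alpha>\<close>] unfolding L_def by blast+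
  \<comment> \<open>The functions \<open>G J\<close> are the convex parts of the majorants; the
    index \<open>J\<close> chooses one likely set in every period.\<close>
  define G where "G J x = ?T x + \<rho> * scenario_risk \<tau> v J x" for J x
  have \<Phi>: "\<Phi> = (\<lambda>x. (?T x + \<rho> * R x) + lam2 * (norm x)\<^sup>2)"
    unfolding \<Phi>_def f_def by (simp add: objective_eq_trading_objective add_ac)
  have R: "piecewise_affine R"
    unfolding R_def by (rule piecewise_affine_risk_penalty[OF VaR L LJ])
  then have pa: "piecewise_affine (\<lambda>x. ?T x + \<rho> * R x)"
    by (intro piecewise_affine_add piecewise_affine_trading_objective piecewise_affine_cmul)
  have cont: "continuous_on UNIV \<Phi>"
    unfolding \<Phi>
    by (rule continuous_on_add[OF piecewise_affine_continuous_on[OF pa]]) (intro continuous_intros)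
  \<comment> \<open>Holding the previous portfolio in all periods is feasible, so the effective
    domain is nonempty.\<close>
  have "(\<chi> t. w_prev) \<in> ?X" using \<open>w_prev \<in> unit_simplex\<close> by (simp add: feasible_set_def)
  then have "edom \<Psi> \<noteq> {}" unfolding \<Psi>_def edom_add_indicator by blast
  then have proper: "proper_fun \<Psi>"
    unfolding proper_fun_def by (simp add: \<Psi>_def indicator_fun_def)
  have closed: "closed_fun \<Psi>"
    unfolding \<Psi>_def
    by (rule closed_fun_add_indicator[OF polyhedron_imp_closed[OF polyhedron_feasible_set] cont])
  have plq: "piecewise_linear_quadratic \<Psi>"
    unfolding \<Psi>_def \<Phi>
    by (rule piecewise_linear_quadratic_norm_square[OF polyhedron_feasible_set pa])
  have "KL_property_at \<Psi> (1/2) z" if z: "z \<in> dom_subdiff \<Psi>" for z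
  proof -
    have "z \<in> ?X"
      using z unfolding dom_subdiff_def limiting_subdiff_def \<Psi>_def indicator_fun_def
      by (auto split: if_splits)
    have "\<exists>\<epsilon>>0. \<forall>x\<in>?X. norm (x - z) < \<epsilon> \<longrightarrow>
        (\<forall>u \<in> frechet_subdiff \<Psi> x. \<Phi> x - \<Phi> z \<le> (norm u)\<^sup>2 / (4 * lam2))"
      unfolding \<Psi>_def
    proof (rule frechet_subdiff_min_strongly_convex[OF _ \<open>z \<in> ?X\<close> \<open>lam2 > 0\<close> _ _ _ _ _ cont])
      show "convex ?X" by (rule polyhedron_imp_convex[OF polyhedron_feasible_set])
      \<comment> \<open>The index set of the majorants is finite: there are finitely many periods
        and finitely many likely sets in each.\<close>
      show "finite (Pi\<^sub>E UNIV L)" using L by (intro finite_PiE) auto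
      fix J assume "J \<in> Pi\<^sub>E UNIV L"
      then have J: "J t \<in> L t" for t by (auto simp: PiE_def)
      have "convex_on UNIV (G J)"
        unfolding G_def using \<open>lam1 > 0\<close> \<open>\<rho> > 0\<close> assms(11)
        by (intro convex_on_add convex_on_cmul convex_on_trading_objective
            convex_on_scenario_risk LJ[OF J]) auto
      then show "convex_on ?X (G J)"
        by (rule convex_on_subset) (simp_all add: polyhedron_imp_convex[OF polyhedron_feasible_set])
      have "piecewise_affine (G J)"
        unfolding G_def by (intro piecewise_affine_add piecewise_affine_cmul
            piecewise_affine_trading_objective piecewise_affine_scenario_risk LJ[OF J])
      then show "continuous_on UNIV (G J)" by (rule piecewise_affine_continuous_on)
      show "\<Phi> y \<le> G J y + lam2 * (norm y)\<^sup>2" for y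
      proof -
        have "R y \<le> scenario_risk \<tau> v J y"
          unfolding R_def by (rule risk_penalty_le_scenario_risk[OF VaR L(1) J])
        then have "\<rho> * R y \<le> \<rho> * scenario_risk \<tau> v J y"
          using \<open>\<rho> > 0\<close> by (intro mult_left_mono) simp_all
        then show ?thesis unfolding \<Phi> G_def by linarith
      qed
    next
      fix y
      obtain J where J: "\<And>t. J t \<in> L t" "R y = scenario_risk \<tau> v J y"
        by (rule risk_penalty_eq_scenario_risk[OF VaR L, where \<tau> = \<tau> and x = y]) (rule that, simp_all add: R_def)
      \<comment> \<open>Periodwise minimizers at \<open>y\<close> give the majorant that touches
        \<Phi> there.\<close>
      have "\<Phi> y = G J y + lam2 * (norm y)\<^sup>2" unfolding \<Phi> G_def J(2) ..
      moreover have "J \<in> Pi\<^sub>E UNIV L" using J(1) by (simp add: PiE_UNIV_domain)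
      ultimately show "\<exists>J\<in>Pi\<^sub>E UNIV L. \<Phi> y = G J y + lam2 * (norm y)\<^sup>2" by (intro bexI)
    qed
    then obtain \<epsilon> where "\<epsilon> > 0" and "\<And>x u. x \<in> ?X \<Longrightarrow> norm (x - z) < \<epsilon> \<Longrightarrow>
        u \<in> frechet_subdiff \<Psi> x \<Longrightarrow> \<Phi> x - \<Phi> z \<le> (norm u)\<^sup>2 / (4 * lam2)"
      by blast
    then show ?thesis
      using proper closed z \<open>lam2 > 0\<close> cont unfolding \<Psi>_def by (intro KL_property_at_half)
  qed
  then show ?thesis
    using proper closed plq piecewise_linear_quadratic_imp_semialgebraic_fun by blast
qed

end
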